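(* Let $p\ge 2$ and let $\mathcal{S}=\{S_1,\ldots,S_p\}$ with $S_i\subseteq\mathbb{N}$ nonempty for $1\le i\le p$. The $\mathcal{S}$-limited shift $X(\mathcal{S})$ is sofic if and only if for every $S_i\in\mathcal{S}$, the difference sequence $\Delta(S_i)$ is eventually periodic.
   Context: $\mathbb{N}=\{1,2,3,\ldots\}$. The alphabet is $\mathcal{A}=\{1,\ldots,p\}$, and $\mathcal{S}=\{S_1,\ldots,S_p\}$ is an indexed family (repetitions allowed). The core set is $G_{\mathcal{S}}=\{1^{m_1}2^{m_2}\cdots p^{m_p} : m_i\in S_i \text{ for } 1\le i\le p\}$, where $a^m$ is the letter $a$ repeated $m$ times. The $\mathcal{S}$-limited shift is the subshift $X(\mathcal{S})\subseteq\mathcal{A}^{\mathbb{Z}}$ given by the closure (in the product topology) of the set of all bi-infinite concatenations $\cdots x_{-1}x_0x_1\cdots$ with $x_i\in G_{\mathcal{S}}$ for all $i\in\mathbb{Z}$ (with the origin placed at any coordinate, so the set is shift-invariant). For a set $S=\{s_0<s_1<s_2<\cdots\}\subseteq\mathbb{N}$, $\Delta(S)$ is the sequence $s_0,d_1,d_2,\ldots$ with $d_j=s_j-s_{j-1}$ for $j\ge1$; when $S$ is finite this is a finite sequence, which by convention counts as eventually periodic. A subshift is sofic if it has a finite labelled graph presentation, equivalently if it has finitely many distinct follower sets $\mathcal{F}_X(\omega)=\{\tau\in\mathcal{L}(X):\omega\tau\in\mathcal{L}(X)\}$, $\omega\in\mathcal{L}(X)$, where $\mathcal{L}(X)$ is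 the set of finite words occurring in points of $X$. *)

theory Defs
  imports "HOL-Analysis.Analysis" "Graph_Theory.Digraph"
begin

definition full_shift :: "'a set \<Rightarrow> (int \<Rightarrow> 'a) topology" where
  "full_shift A = product_topology (\<lambda>_::int. discrete_topology A) UNIV"

definition core_set :: "nat \<Rightarrow> (nat \<Rightarrow> nat set) \<Rightarrow> nat list set" where
  "core_set p S =
     {concat (map (\<lambda>i. replicate (m i) i) [1..<Suc p]) | m. \<forall>i\<in>{1..p}. m i \<in> S i}"

(* The word w i occupies the coordinates k i, ..., k (i + 1) - 1 of x.  The value k 0 is
   unconstrained, so the origin may fall anywhere.  The definition is meant for sets W of
   nonempty words: then k is strictly increasing and the words cover all of the integers. *)
definition biinfinite_concats :: "'a list set \<Rightarrow> (int \<Rightarrow> 'a) set" where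
  "biinfinite_concats W =
     {x. \<exists>w :: int \<Rightarrow> 'a list. \<exists>k :: int \<Rightarrow> int.
        (\<forall>i. w i \<in> W \<and> k (i + 1) = k i + int (length (w i)) \<and>
             (\<forall>j < length (w i). x (k i + int j) = w i ! j))}"

definition limited_shift :: "nat \<Rightarrow> (nat \<Rightarrow> nat set) \<Rightarrow> (int \<Rightarrow> nat) set" where
  "limited_shift p S = full_shift {1..p} closure_of biinfinite_concats (core_set p S)"

definition biinfinite_walk :: "('v, 'e) pre_digraph \<Rightarrow> (int \<Rightarrow> 'e) \<Rightarrow> bool" where
  "biinfinite_walk G e \<longleftrightarrow> (\<forall>i. e i \<in> arcs G \<and> head G (e i) = tail G (e (i + 1)))"

(* Loops and multiple arcs are allowed.  Since the graph is finite, taking natural numbers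
   as vertices and arcs is no restriction. *)
definition sofic :: "(int \<Rightarrow> 'a) set \<Rightarrow> bool" where
  "sofic X \<longleftrightarrow>
     (\<exists>(G :: (nat, nat) pre_digraph) (lab :: nat \<Rightarrow> 'a).
        fin_digraph G \<and> X = {\<lambda>i. lab (e i) | e. biinfinite_walk G e})"

(* A finite sequence of length n is a partial function with domain {..<n}.  For finite S,
   enumerate S j is the j-th smallest element only for j < card S. *)
definition Delta :: "nat set \<Rightarrow> nat \<Rightarrow> nat option" where
  "Delta S j =
     (if finite S \<and> card S \<le> j then None
      else if j = 0 then Some (enumerate S 0)
      else Some (enumerate S j - enumerate S (j - 1)))"

(* The first disjunct is the convention that finite sequences are eventually periodic. *)
definition eventually_periodic :: "(nat \<Rightarrow> 'a option) \<Rightarrow> bool" where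
  "eventually_periodic a \<longleftrightarrow>
     finite (dom a) \<or> (\<exists>N. \<exists>q>0. \<forall>n\<ge>N. a (n + q) = a n)"

end

theory Submission
  imports Defs
begin

text \<open>The language of the shift is the set \<open>L\<close> of factors of concatenations of core words, and
  the shift consists of the points all of whose windows lie in \<open>L\<close>. So it is sofic if and only if
  \<open>L\<close> has finitely many residuals (follower sets). If all \<open>S i\<close> are eventually periodic, this holds
  since having finitely many residuals is preserved by concatenation, Kleene star and passing to
  factors. Conversely, a word of \<open>L\<close> in which a nonempty run \<open>i\<^sup>n\<close> has both neighbours
  different from \<open>i\<close> forces \<open>n \<in> S i\<close>; by pigeonhole two words ending in \<open>i\<^sup>k\<close> and \<open>i\<^sup>l\<close>,
  \<open>k < l\<close>, have equal residuals, which makes \<open>S i\<close> eventually periodic with period \<open>l - k\<close>.\<close>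

section \<open>Eventually periodic sets and their difference sequences\<close>

definition eventually_periodic_set :: "nat set \<Rightarrow> bool" where
  "eventually_periodic_set S \<longleftrightarrow> (\<exists>N. \<exists>q>0. \<forall>n\<ge>N. n + q \<in> S \<longleftrightarrow> n \<in> S)"

lemma finite_imp_eventually_periodic_set:
  assumes "finite S"
  shows "eventually_periodic_set S"
proof -
  obtain N where "\<forall>n\<in>S. n < N"
    using assms finite_nat_set_iff_bounded by blast
  then have "\<forall>n\<ge>N. n + 1 \<in> S \<longleftrightarrow> n \<in> S"
    by (metis le_add1 leD le_trans)
  then show ?thesis
    unfolding eventually_periodic_set_def by (meson zero_less_one)
qed

text \<open>Translation by \<open>q\<close> maps the part of \<open>S\<close> from \<open>N\<close>
  on, in order, onto the part from \<open>N + q\<close> on. Once it matches the indices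
  \<open>M\<close> and \<open>M + c\<close>, passing to successors matches all later pairs.\<close>

lemma enumerate_shift:
  fixes S :: "nat set"
  assumes inf: "infinite S"
    and per: "\<And>n. n \<ge> N \<Longrightarrow> n + q \<in> S \<longleftrightarrow> n \<in> S"
    and M: "enumerate S M \<ge> N" "enumerate S (M + c) = enumerate S M + q"
  shows "enumerate S (M + k + c) = enumerate S (M + k) + q"
proof (induction k)
  case 0
  then show ?case using M by simp
next
  case (Suc k)
  let ?s = "enumerate S (M + k)" and ?t = "enumerate S (Suc (M + k))"
  have sN: "N \<le> ?s"
    using M(1) inf by (metis enumerate_mono_le_iff le_add1 le_trans)
  have t: "?t \<in> S" "?s < ?t"
    using inf by (auto simp: enumerate_in_set enumerate_step)
  have "enumerate S (Suc (M + k + c)) = (LEAST s. s \<in> S \<and> ?s + q < s)"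
    using enumerate_Suc'' [OF inf] Suc by simp
  also have "\<dots> = ?t + q"
  proof (rule Least_equality)
    show "?t + q \<in> S \<and> ?s + q < ?t + q"
      using t per sN by auto
  next
    fix y assume y: "y \<in> S \<and> ?s + q < y"
    then have "y - q \<in> S" "?s < y - q"
      using per[of "y - q"] sN by auto
    then have "?t \<le> y - q"
      unfolding enumerate_Suc'' [OF inf] by (intro Least_le) auto
    then show "?t + q \<le> y" using y by auto
  qed
  finally show ?case by simp
qed

text \<open>The differences telescope: equal steps at indices \<open>r\<close> apart keep the gap
  \<open>enumerate S (n + r) - enumerate S n\<close> constant from \<open>M\<close> on. That gap
  becomes the period of the set.\<close>

lemma enumerate_shift_of_Delta:
  fixes S :: "nat set"
  assumes inf: "infinite S" and per: "\<And>n. n \<ge> M \<Longrightarrow> Delta S (n + r) = Delta S n"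
  shows "enumerate S (M + k + r) = enumerate S (M + k) + (enumerate S (M + r) - enumerate S M)"
proof (induction k)
  case 0
  have "enumerate S M \<le> enumerate S (M + r)" using inf by (simp add: enumerate_mono_le_iff)
  then show ?case by simp
next
  case (Suc k)
  have "enumerate S (Suc (M + k + r)) - enumerate S (M + k + r)
      = enumerate S (Suc (M + k)) - enumerate S (M + k)"
    using per[of "Suc (M + k)"] inf by (simp add: Delta_def split: if_splits)
  moreover have "enumerate S (M + k + r) < enumerate S (Suc (M + k + r))"
    "enumerate S (M + k) < enumerate S (Suc (M + k))"
    using inf by (auto simp: enumerate_step)
  ultimately show ?case using Suc by simp
qed

text \<open>For infinite \<open>S\<close> two kinds of period are exchanged: a period
  \<open>r\<close> of the differences gives the sum of \<open>r\<close> consecutive differences as a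
  period of the set, and a period \<open>q\<close> of the set gives the number of elements in a
  stretch of length \<open>q\<close> as a period of the differences.\<close>

lemma eventually_periodic_Delta_iff:
  "eventually_periodic (Delta S) \<longleftrightarrow> eventually_periodic_set S"
proof (cases "finite S")
  case True
  have "dom (Delta S) \<subseteq> {..<card S}"
    using True by (auto simp: Delta_def split: if_splits)
  then have "eventually_periodic (Delta S)"
    unfolding eventually_periodic_def by (meson finite_lessThan finite_subset)
  then show ?thesis using finite_imp_eventually_periodic_set[OF True] by simp
next
  case inf: False
  have "dom (Delta S) = UNIV"
    using inf by (auto simp: Delta_def)
  then have iff: "eventually_periodic (Delta S) \<longleftrightarrow>
      (\<exists>N. \<exists>q>0. \<forall>n\<ge>N. Delta S (n + q) = Delta S n)"
    unfolding eventually_periodic_def by simp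
  have le: "enumerate S i \<le> enumerate S j \<longleftrightarrow> i \<le> j" for i j
    using inf by (rule enumerate_mono_le_iff)
  have inS: "enumerate S i \<in> S" for i
    using inf by (rule enumerate_in_set)
  have enumE: thesis if "s \<in> S" "\<And>j. enumerate S j = s \<Longrightarrow> thesis" for s thesis
    using enumerate_Ex[OF inf that(1)] that(2) by (elim exE)
  show ?thesis
  proof
    assume "eventually_periodic (Delta S)"
    then obtain M r where r: "r > 0" and per: "\<And>n. n \<ge> M \<Longrightarrow> Delta S (n + r) = Delta S n"
      using iff by blast
    define q where "q = enumerate S (M + r) - enumerate S M"
    have less: "enumerate S M < enumerate S (M + r)" using inf r by simp
    then have "q > 0" by (simp add: q_def)
    have shift: "enumerate S (M + k + r) = enumerate S (M + k) + q" for k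
      using enumerate_shift_of_Delta[OF inf per] q_def by simp
    have "n + q \<in> S \<longleftrightarrow> n \<in> S" if n: "n \<ge> enumerate S M" for n
    proof
      assume "n \<in> S"
      then obtain j where j: "enumerate S j = n" by (rule enumE)
      then have "M \<le> j" using n le[of M j] by simp
      then have "n + q = enumerate S (j + r)" using shift[of "j - M"] j by simp
      then show "n + q \<in> S" using inS[of "j + r"] by simp
    next
      assume "n + q \<in> S"
      then obtain j where j: "enumerate S j = n + q" by (rule enumE)
      then have "enumerate S (M + r) \<le> enumerate S j" using n less by (simp add: q_def)
      then have "M + r \<le> j" using le[of "M + r" j] by simp
      then have "n = enumerate S (j - r)" using shift[of "j - r - M"] j by simp
      then show "n \<in> S" using inS[of "j - r"] by simp
    qed
    with \<open>q > 0\<close> show "eventually_periodic_set S"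
      unfolding eventually_periodic_set_def by blast
  next
    assume "eventually_periodic_set S"
    then obtain N q where q: "q > 0" and per: "\<And>n. n \<ge> N \<Longrightarrow> n + q \<in> S \<longleftrightarrow> n \<in> S"
      unfolding eventually_periodic_set_def by blast
    \<comment> \<open>Lets the threshold \<open>N\<close> for values serve as a threshold for
      indices too.\<close>
    have N: "enumerate S N \<ge> N" using inf by (simp add: le_enumerate)
    then have "enumerate S N + q \<in> S" using per[of "enumerate S N"] inS[of N] by simp
    then obtain j where j: "enumerate S j = enumerate S N + q" by (rule enumE)
    then have "N < j" using q le[of j N] by simp
    define c where "c = j - N"
    have c: "c > 0" "enumerate S (N + c) = enumerate S N + q" using \<open>N < j\<close> j by (auto simp: c_def)
    note shift = enumerate_shift[OF inf per N c(2)]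
    \<comment> \<open>\<open>Suc N\<close>, since \<open>Delta S n\<close> also involves the element
      of index \<open>n - 1\<close>.\<close>
    have "Delta S (n + c) = Delta S n" if "n \<ge> Suc N" for n
      using shift[of "n - N"] shift[of "n - 1 - N"] that inf by (simp add: Delta_def)
    then show "eventually_periodic (Delta S)" using iff c(1) by blast
  qed
qed

section \<open>Languages with finitely many residuals\<close>

definition residual :: "'a list set \<Rightarrow> 'a list \<Rightarrow> 'a list set" where
  "residual A u = {v. u @ v \<in> A}"

text \<open>The Myhill-Nerode form of regularity. For a factor-closed language, words outside it add
  only the empty residual, so this says that there are finitely many follower sets.\<close>

definition regular :: "'a list set \<Rightarrow> bool" where
  "regular A \<longleftrightarrow> finite (range (residual A))"

definition conc :: "'a list set \<Rightarrow> 'a list set \<Rightarrow> 'a list set" where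
  "conc A B = {u @ v | u v. u \<in> A \<and> v \<in> B}"

definition star :: "'a list set \<Rightarrow> 'a list set" where
  "star A = concat ` lists A"

definition factors :: "'a list set \<Rightarrow> 'a list set" where
  "factors A = {v. \<exists>x y. x @ v @ y \<in> A}"

lemma regularI: "finite R \<Longrightarrow> (\<And>u. residual A u \<in> R) \<Longrightarrow> regular A"
  unfolding regular_def by (rule finite_subset[of _ R]) auto

text \<open>The cut between the two factors of \<open>u @ v\<close> falls either in \<open>v\<close>
  or in \<open>u\<close>; each part of the union is one case.\<close>

lemma residual_conc:
  "residual (conc A B) u =
     conc (residual A u) B \<union> \<Union>{residual B u2 | u1 u2. u = u1 @ u2 \<and> u1 \<in> A}"
  (is "?l = ?r")
proof
  show "?l \<subseteq> ?r"
  proof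
    fix v assume "v \<in> ?l"
    then obtain a b where "u @ v = a @ b" "a \<in> A" "b \<in> B"
      by (auto simp: residual_def conc_def)
    then consider us where "u = a @ us" "us @ v = b" | us where "u @ us = a" "v = us @ b"
      by (auto simp: append_eq_append_conv2)
    then show "v \<in> ?r"
    proof cases
      case 1
      then have "v \<in> residual B us" using \<open>b \<in> B\<close> by (simp add: residual_def)
      then show ?thesis using 1 \<open>a \<in> A\<close> by blast
    next
      case 2
      then show ?thesis using \<open>a \<in> A\<close> \<open>b \<in> B\<close> by (auto simp: residual_def conc_def)
    qed
  qed
  show "?r \<subseteq> ?l"
  proof
    fix v assume "v \<in> ?r"
    then consider v1 v2 where "v = v1 @ v2" "u @ v1 \<in> A" "v2 \<in> B"
      | u1 u2 where "u = u1 @ u2" "u1 \<in> A" "u2 @ v \<in> B"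
      unfolding residual_def conc_def by blast
    then show "v \<in> ?l"
    proof cases
      case 1
      then have "u @ v = (u @ v1) @ v2" by simp
      then show ?thesis using 1 unfolding residual_def conc_def by blast
    next
      case 2
      then have "u @ v = u1 @ (u2 @ v)" by simp
      then show ?thesis using 2 unfolding residual_def conc_def by blast
    qed
  qed
qed

text \<open>A residual of the product is determined by one residual of \<open>A\<close> and a set of
  residuals of \<open>B\<close>, which leaves finitely many.\<close>

lemma regular_conc:
  assumes "regular A" "regular B"
  shows "regular (conc A B)"
proof (rule regularI)
  let ?R = "(\<lambda>(R, T). conc R B \<union> \<Union>T) ` (range (residual A) \<times> Pow (range (residual B)))"
  show "finite ?R" using assms by (simp add: regular_def)
  show "residual (conc A B) u \<in> ?R" for u
    unfolding residual_conc
    by (rule image_eqI[where x = "(residual A u, {residual B u2 | u1 u2. u = u1 @ u2 \<and> u1 \<in> A})"])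
      (simp, blast)
qed

lemma star_iff: "w \<in> star A \<longleftrightarrow> (\<exists>ws. concat ws = w \<and> set ws \<subseteq> A)"
  by (auto simp: star_def)

lemma star_append:
  assumes "u \<in> star A" "v \<in> star A"
  shows "u @ v \<in> star A"
proof -
  obtain us vs where "concat us = u" "set us \<subseteq> A" "concat vs = v" "set vs \<subseteq> A"
    using assms unfolding star_iff by blast
  then show ?thesis unfolding star_iff by (intro exI[of _ "us @ vs"]) simp
qed

lemma Nil_in_star: "[] \<in> star A"
  unfolding star_iff by (rule exI[of _ "[]"]) simp

lemma subset_star: "u \<in> A \<Longrightarrow> u \<in> star A"
  unfolding star_iff by (rule exI[of _ "[u]"]) simp

text \<open>\<open>u2\<close> is the part within \<open>u\<close> of the first block that reaches or
  crosses the end of \<open>u\<close>, and \<open>u1\<close> consists of the blocks before it. For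
  empty \<open>u\<close> there need be no such block.\<close>

lemma concat_eq_appendD:
  assumes "concat ws = u @ v" "set ws \<subseteq> A" "u \<noteq> []"
  shows "\<exists>u1 u2. u = u1 @ u2 \<and> u1 \<in> star A \<and> v \<in> conc (residual A u2) (star A)"
  using assms
proof (induction ws arbitrary: u)
  case Nil
  then show ?case by simp
next
  case (Cons w ws)
  have ws: "concat ws \<in> star A" using Cons.prems by (auto simp: star_def)
  have "\<exists>us. w = u @ us \<and> us @ concat ws = v \<or> w @ us = u \<and> concat ws = us @ v"
    using Cons.prems(1) by (simp add: append_eq_append_conv2)
  \<comment> \<open>A block ending exactly at the end of \<open>u\<close> goes to the second case
    with \<open>us = []\<close>, so that the induction hypothesis only meets a nonempty
    \<open>us\<close>.\<close>
  then consider us where "u = w @ us" "us \<noteq> []" "concat ws = us @ v"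
    | us where "w = u @ us" "v = us @ concat ws"
    by (metis append_Nil append_Nil2)
  then show ?case
  proof cases
    case 1
    then obtain u1 u2 where "us = u1 @ u2" "u1 \<in> star A" "v \<in> conc (residual A u2) (star A)"
      using Cons by auto
    moreover have "w \<in> star A" using Cons.prems(2) by (simp add: subset_star)
    ultimately show ?thesis using 1 star_append by (metis append.assoc)
  next
    case 2
    then have "v \<in> conc (residual A u) (star A)"
      using ws Cons.prems(2) by (auto simp: conc_def residual_def)
    then show ?thesis using Nil_in_star by fastforce
  qed
qed

lemma residual_star:
  assumes "u \<noteq> []"
  shows "residual (star A) u =
    \<Union>{conc (residual A u2) (star A) | u1 u2. u = u1 @ u2 \<and> u1 \<in> star A}" (is "?l = ?r")
proof
  show "?l \<subseteq> ?r"
  proof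
    fix v assume "v \<in> ?l"
    then obtain ws where "concat ws = u @ v" "set ws \<subseteq> A"
      unfolding residual_def star_iff by blast
    from concat_eq_appendD[OF this assms] show "v \<in> ?r" by blast
  qed
  show "?r \<subseteq> ?l"
  proof
    fix v assume "v \<in> ?r"
    then obtain u1 u2 v1 v2 where uv: "u = u1 @ u2" "u1 \<in> star A" "v = v1 @ v2"
      "u2 @ v1 \<in> A" "v2 \<in> star A"
      by (auto simp: conc_def residual_def)
    then have "u1 @ ((u2 @ v1) @ v2) \<in> star A" by (metis star_append subset_star)
    then show "v \<in> ?l" using uv by (simp add: residual_def)
  qed
qed

text \<open>Residuals of nonempty words are unions of sets \<open>conc R (star A)\<close> with
  \<open>R\<close> a residual of \<open>A\<close>; the empty word adds only \<open>star A\<close>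
  itself.\<close>

lemma regular_star:
  assumes "regular A"
  shows "regular (star A)"
proof (rule regularI)
  let ?R = "insert (star A) (Union ` Pow ((\<lambda>R. conc R (star A)) ` range (residual A)))"
  show "finite ?R" using assms by (simp add: regular_def)
  show "residual (star A) u \<in> ?R" for u
  proof (cases "u = []")
    case True
    then show ?thesis by (simp add: residual_def)
  next
    case False
    show ?thesis
      by (subst residual_star[OF False], rule insertI2, rule imageI) auto
  qed
qed

text \<open>A residual by \<open>u\<close> depends only on the set of residuals of \<open>A\<close>
  by all words \<open>x @ u\<close>, a subset of a finite set.\<close>

lemma regular_factors:
  assumes "regular A"
  shows "regular (factors A)"
proof (rule regularI)
  let ?f = "\<lambda>T. {v. \<exists>R\<in>T. \<exists>y. v @ y \<in> R}"
  show "finite (?f ` Pow (range (residual A)))" using assms by (simp add: regular_def)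
  show "residual (factors A) u \<in> ?f ` Pow (range (residual A))" for u
    by (rule image_eqI[where x = "range (\<lambda>x. residual A (x @ u))"])
      (force simp: residual_def factors_def, blast)
qed

lemma factors_append: "u @ v @ w \<in> factors A \<Longrightarrow> v \<in> factors A"
  unfolding factors_def by (auto, metis append.assoc)

lemma factors_star_subset_lists:
  assumes "W \<subseteq> lists A"
  shows "factors (star W) \<subseteq> lists A"
proof
  fix v assume "v \<in> factors (star W)"
  then obtain x y ws where ws: "concat ws = x @ v @ y" "set ws \<subseteq> W"
    unfolding factors_def star_iff by blast
  have "set v \<subseteq> set (concat ws)" by (auto simp: ws(1))
  also have "\<dots> \<subseteq> A" using ws(2) assms by auto
  finally show "v \<in> lists A" by auto
qed

section \<open>Regularity of the core set\<close>

lemma append_eq_replicateD: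
  assumes "u @ v = replicate n a"
  shows "u = replicate (length u) a" "v = replicate (length v) a" "n = length u + length v"
proof -
  show n: "n = length u + length v" using assms by (metis length_append length_replicate)
  show "u = replicate (length u) a" "v = replicate (length v) a"
    using assms by (auto simp: n replicate_add)
qed

text \<open>The residual by \<open>k\<close> copies of \<open>a\<close> depends only on
  \<open>S\<close> translated by \<open>k\<close> to the left, and from \<open>N\<close> on these
  translates recur with period \<open>q\<close>; a word with another letter has empty
  residual.\<close>

lemma regular_replicate:
  assumes "eventually_periodic_set S"
  shows "regular {replicate m a | m. m \<in> S}"
proof -
  obtain N q where q: "q > 0" and per: "\<And>n. n \<ge> N \<Longrightarrow> n + q \<in> S \<longleftrightarrow> n \<in> S"
    using assms unfolding eventually_periodic_set_def by blast
  let ?A = "{replicate m a | m. m \<in> S}"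
  let ?r = "\<lambda>k. {replicate m a | m. k + m \<in> S}"
  have res: "residual ?A (replicate k a) = ?r k" for k
  proof -
    have "v \<in> ?r k" if "replicate k a @ v = replicate m a" "m \<in> S" for v m
      using append_eq_replicateD[OF that(1)] that(2) by auto
    moreover have "\<exists>m'. replicate k a @ replicate m a = replicate m' a \<and> m' \<in> S"
      if "k + m \<in> S" for m
      using that by (intro exI[of _ "k + m"]) (simp add: replicate_add)
    ultimately show ?thesis by (auto simp: residual_def)
  qed
  \<comment> \<open>Descent: as long as \<open>k \<ge> N + q\<close>, replacing \<open>k\<close> by
    \<open>k - q\<close> does not change the set.\<close>
  have fold: "?r k \<in> ?r ` {..<N + q}" for k
  proof (induction k rule: less_induct)
    case (less k)
    show ?case
    proof (cases "k < N + q")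
      case False
      then have "k + m \<in> S \<longleftrightarrow> k - q + m \<in> S" for m
        using per[of "k - q + m"] by (simp add: add.commute add.left_commute)
      then have "?r k = ?r (k - q)" by simp
      then show ?thesis using less[of "k - q"] False q by simp
    qed blast
  qed
  show ?thesis
  proof (rule regularI)
    show "finite (insert {} (?r ` {..<N + q}))" by simp
    show "residual ?A u \<in> insert {} (?r ` {..<N + q})" for u
    proof (cases "u = replicate (length u) a")
      case True
      then show ?thesis using res fold by (metis (no_types, lifting) insertI2)
    next
      case False
      then have "residual ?A u = {}"
        using append_eq_replicateD(1) by (fastforce simp: residual_def)
      then show ?thesis by simp
    qed
  qed
qed

definition runs :: "('a \<Rightarrow> nat) \<Rightarrow> 'a list \<Rightarrow> 'a list" where
  "runs m xs = concat (map (\<lambda>i. replicate (m i) i) xs)"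

lemma runs_Nil [simp]: "runs m [] = []"
  and runs_Cons: "runs m (i # xs) = replicate (m i) i @ runs m xs"
  and runs_append: "runs m (xs @ ys) = runs m xs @ runs m ys"
  by (simp_all add: runs_def)

lemma runs_fun_upd: "i \<notin> set xs \<Longrightarrow> runs (m(i := n)) xs = runs m xs"
  by (induction xs) (auto simp: runs_Cons)

lemma set_runs: "set (runs m xs) \<subseteq> set xs"
  by (auto simp: runs_def)

lemma runs_eq_Nil: "runs m xs = [] \<Longrightarrow> (\<And>i. i \<in> set xs \<Longrightarrow> m i \<ge> 1) \<Longrightarrow> xs = []"
  by (cases xs) (force simp: runs_Cons)+

lemma core_set_eq: "core_set p S = {runs m [1..<Suc p] | m. \<forall>i\<in>{1..p}. m i \<in> S i}"
  by (simp only: core_set_def runs_def)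

text \<open>The exponents are chosen independently, so the core set is a product of one-letter
  languages; regularity then follows by induction on \<open>p\<close>.\<close>

lemma core_set_Suc:
  "core_set (Suc p) S = conc (core_set p S) {replicate m (Suc p) | m. m \<in> S (Suc p)}" (is "?l = ?r")
proof
  have runs_Suc: "runs m [1..<Suc (Suc p)] = runs m [1..<Suc p] @ replicate (m (Suc p)) (Suc p)"
    for m :: "nat \<Rightarrow> nat"
    by (simp add: runs_append runs_Cons)
  show "?l \<subseteq> ?r"
  proof
    fix w assume "w \<in> ?l"
    then obtain m where m: "\<forall>i\<in>{1..Suc p}. m i \<in> S i" "w = runs m [1..<Suc (Suc p)]"
      unfolding core_set_eq by blast
    then have "runs m [1..<Suc p] \<in> core_set p S" "m (Suc p) \<in> S (Suc p)"
      by (auto simp: core_set_eq)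
    then show "w \<in> ?r" unfolding conc_def m(2) runs_Suc by blast
  qed
  show "?r \<subseteq> ?l"
  proof
    fix w assume "w \<in> ?r"
    then obtain m n where m: "\<forall>i\<in>{1..p}. m i \<in> S i" "n \<in> S (Suc p)"
      and w: "w = runs m [1..<Suc p] @ replicate n (Suc p)"
      unfolding conc_def core_set_eq by blast
    have "runs (m(Suc p := n)) [1..<Suc p] = runs m [1..<Suc p]"
      by (rule runs_fun_upd) simp
    then have "w = runs (m(Suc p := n)) [1..<Suc (Suc p)]"
      unfolding runs_Suc w by (metis fun_upd_same)
    moreover have "\<forall>i\<in>{1..Suc p}. (m(Suc p := n)) i \<in> S i" using m by (auto simp: le_Suc_eq)
    ultimately show "w \<in> ?l" unfolding core_set_eq by blast
  qed
qed

lemma regular_core_set: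
  assumes "\<And>i. i \<in> {1..p} \<Longrightarrow> eventually_periodic_set (S i)"
  shows "regular (core_set p S)"
  using assms
proof (induction p)
  case 0
  show ?case
  proof (rule regularI)
    show "finite {{[]}, {} :: nat list set}" by simp
    show "residual (core_set 0 S) u \<in> {{[]}, {}}" for u
      by (auto simp: core_set_def residual_def)
  qed
next
  case (Suc p)
  then show ?case
    unfolding core_set_Suc by (intro regular_conc regular_replicate) auto
qed

section \<open>Sofic shifts and follower sets\<close>

definition window :: "(int \<Rightarrow> 'a) \<Rightarrow> int \<Rightarrow> nat \<Rightarrow> 'a list" where
  "window x a n = map (\<lambda>j. x (a + int j)) [0..<n]"

definition language :: "(int \<Rightarrow> 'a) set \<Rightarrow> 'a list set" where
  "language X = {window x a n | x a n. x \<in> X}"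

definition shift_of :: "'a list set \<Rightarrow> (int \<Rightarrow> 'a) set" where
  "shift_of L = {x. \<forall>a n. window x a n \<in> L}"

lemma shift_ofD: "x \<in> shift_of L \<Longrightarrow> window x a n \<in> L"
  by (simp add: shift_of_def)

lemma languageI: "x \<in> X \<Longrightarrow> window x a n \<in> language X"
  by (auto simp: language_def)

lemma length_window [simp]: "length (window x a n) = n"
  by (simp add: window_def)

lemma nth_window [simp]: "j < n \<Longrightarrow> window x a n ! j = x (a + int j)"
  by (simp add: window_def)

lemma window_add: "window x a (m + n) = window x a m @ window x (a + int m) n"
  by (rule nth_equalityI) (auto simp: nth_append algebra_simps)

lemma window_Suc: "window x a (Suc n) = window x a n @ [x (a + int n)]"
  by (simp add: window_def)

lemma window_eq_appendD:
  assumes "window x a n = u @ v"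
  shows "u = window x a (length u)" "v = window x (a + int (length u)) (length v)"
proof -
  have "n = length u + length v" using assms by (metis length_window length_append)
  then have "u @ v = window x a (length u) @ window x (a + int (length u)) (length v)"
    using assms window_add by metis
  then show "u = window x a (length u)" "v = window x (a + int (length u)) (length v)"
    by (auto simp: append_eq_append_conv)
qed

lemma window_cong:
  "(\<And>t. a \<le> t \<Longrightarrow> t < a + int n \<Longrightarrow> x t = y t) \<Longrightarrow> window x a n = window y a n"
  by (simp add: window_def)

text \<open>Allows a presentation by labelled edges between states of any type. The states are sent
  injectively to natural numbers and the edges are numbered, which gives the graph that
  \<open>sofic\<close> asks for.\<close>

lemma soficI:
  fixes E :: "('v \<times> 'a \<times> 'v) set"
  assumes "finite E" and X: "X = {x. \<exists>q. \<forall>t::int. (q t, x t, q (t + 1)) \<in> E}"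
  shows "sofic X"
proof -
  let ?V = "fst ` E \<union> (snd \<circ> snd) ` E"
  obtain f :: "'v \<Rightarrow> nat" where f: "inj_on f ?V"
    using \<open>finite E\<close> finite_imp_inj_to_nat_seg[of ?V] by auto
  obtain g where g: "bij_betw g {0..<card E} E"
    using \<open>finite E\<close> ex_bij_betw_nat_finite by blast
  define G :: "(nat, nat) pre_digraph" where
    "G = \<lparr>verts = f ` ?V, arcs = {0..<card E}, tail = (\<lambda>n. f (fst (g n))),
          head = (\<lambda>n. f (snd (snd (g n))))\<rparr>"
  let ?lab = "\<lambda>n. fst (snd (g n))"
  have gE: "g n \<in> E" if "n < card E" for n using g that by (auto simp: bij_betw_def)
  have "fin_digraph G"
    by unfold_locales (use \<open>finite E\<close> gE in \<open>auto simp: G_def\<close>)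
  moreover have "X = {\<lambda>i. ?lab (e i) | e. biinfinite_walk G e}"
  proof (intro set_eqI iffI)
    fix x assume "x \<in> X"
    then obtain q where q: "\<And>t. (q t, x t, q (t + 1)) \<in> E" using X by blast
    define e where "e t = inv_into {0..<card E} g (q t, x t, q (t + 1))" for t
    have "g (e t) = (q t, x t, q (t + 1))" "e t < card E" for t
      using q[of t] g unfolding e_def bij_betw_def
      by (auto simp: f_inv_into_f) (metis atLeastLessThan_iff inv_into_into)
    then have "biinfinite_walk G e" "x = (\<lambda>i. ?lab (e i))"
      by (auto simp: biinfinite_walk_def G_def)
    then show "x \<in> {\<lambda>i. ?lab (e i) | e. biinfinite_walk G e}" by blast
  next
    fix x assume "x \<in> {\<lambda>i. ?lab (e i) | e. biinfinite_walk G e}"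
    then obtain e where e: "biinfinite_walk G e" and x: "x = (\<lambda>i. ?lab (e i))" by blast
    define q where "q t = fst (g (e t))" for t
    have E: "g (e t) \<in> E" for t using e gE by (simp add: biinfinite_walk_def G_def)
    \<comment> \<open>Adjacency in the graph only equates the encoded states; injectivity of
      \<open>f\<close> recovers the equality of the states.\<close>
    have "snd (snd (g (e t))) = q (t + 1)" for t
    proof (rule inj_onD[OF f])
      show "f (snd (snd (g (e t)))) = f (q (t + 1))"
        using e by (simp add: biinfinite_walk_def G_def q_def)
      show "snd (snd (g (e t))) \<in> ?V" using E[of t] by force
      show "q (t + 1) \<in> ?V" using E[of "t + 1"] unfolding q_def by blast
    qed
    then have "(q t, x t, q (t + 1)) = g (e t)" for t
      unfolding q_def x by (metis prod.collapse)
    then have "\<forall>t. (q t, x t, q (t + 1)) \<in> E" using E by simp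
    then show "x \<in> X" unfolding X by blast
  qed
  ultimately show ?thesis unfolding sofic_def by (intro exI conjI)
qed

lemma residual_snoc: "residual L (u @ [a]) = {v. a # v \<in> residual L u}"
  by (simp add: residual_def)

lemma finite_range_decseq_stabilizes:
  fixes f :: "nat \<Rightarrow> 'b set"
  assumes "finite (range f)" "\<And>m n. m \<le> n \<Longrightarrow> f n \<subseteq> f m"
  obtains N where "\<And>n. n \<ge> N \<Longrightarrow> f n = (\<Inter>m. f m)"
proof -
  obtain N where N: "\<And>n. f n \<subseteq> f N \<Longrightarrow> f n = f N"
    using finite_has_minimal[OF assms(1)] by (metis UNIV_I empty_not_UNIV image_iff image_is_empty)
  have N': "f N \<subseteq> f m" for m
    using N[of m] assms(2)[of N m] assms(2)[of m N] by (cases "m \<le> N") auto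
  then have "f N = (\<Inter>m. f m)" by blast
  moreover have "f n = f N" if "n \<ge> N" for n using N assms(2) that by blast
  ultimately show thesis using that by metis
qed

text \<open>The presentation is the follower set graph: reading \<open>a\<close> leads from the
  residual of \<open>u\<close> to that of \<open>u @ [a]\<close>, provided that this word is in
  \<open>L\<close>.\<close>

lemma sofic_shift_of:
  fixes L :: "'a list set"
  assumes reg: "regular L" and fin: "finite A" "L \<subseteq> lists A"
    and fac: "\<And>u v w. u @ v @ w \<in> L \<Longrightarrow> v \<in> L"
  shows "sofic (shift_of L)"
proof -
  define E where "E = {(residual L u, a, residual L (u @ [a])) | u a. u @ [a] \<in> L}"
  have "E \<subseteq> range (residual L) \<times> A \<times> range (residual L)"
    using fin(2) by (fastforce simp: E_def)
  then have "finite E" using reg fin(1) unfolding regular_def by (meson finite_SigmaI finite_subset)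
  moreover have "shift_of L = {x. \<exists>q. \<forall>t::int. (q t, x t, q (t + 1)) \<in> E}"
  proof (intro set_eqI iffI)
    fix x assume x: "x \<in> shift_of L"
    \<comment> \<open>The follower sets of ever longer pasts of \<open>t\<close> decrease in a finite family, so they
      stabilize; the limits are the states of a walk, and no compactness argument is needed.\<close>
    define F where "F t n = residual L (window x (t - int n) n)" for t n
    define q where "q t = (\<Inter>n. F t n)" for t
    have dec: "F t n \<subseteq> F t m" if "m \<le> n" for t m n
    proof -
      have "window x (t - int n) n = window x (t - int n) (n - m) @ window x (t - int m) m"
        using window_add[of x "t - int n" "n - m" m] that by (simp add: of_nat_diff)
      then show ?thesis
        using fac[of _ _ "[]"] by (auto simp: F_def residual_def)
    qed
    have lim: "\<exists>N. \<forall>n\<ge>N. F t n = q t" for t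
    proof -
      have "finite (range (F t))"
        by (rule finite_subset[OF _ reg[unfolded regular_def]]) (auto simp: F_def)
      then show ?thesis
        using finite_range_decseq_stabilizes[of "F t"] dec q_def by metis
    qed
    have "(q t, x t, q (t + 1)) \<in> E" for t
    proof -
      obtain N M where "\<forall>n\<ge>N. F t n = q t" "\<forall>n\<ge>M. F (t + 1) n = q (t + 1)" using lim by metis
      \<comment> \<open>Both limits are reached at pasts with the same left end: the past of
        \<open>t + 1\<close> of length \<open>Suc (N + M)\<close> is the past of \<open>t\<close> of
        length \<open>N + M\<close> followed by \<open>x t\<close>.\<close>
      then have *: "F t (N + M) = q t" "F (t + 1) (Suc (N + M)) = q (t + 1)" by auto
      let ?u = "window x (t - int (N + M)) (N + M)"
      have u: "window x (t - int (N + M)) (Suc (N + M)) = ?u @ [x t]"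
        by (simp add: window_Suc)
      then have "?u @ [x t] \<in> L" using shift_ofD[OF x] by metis
      moreover have "residual L ?u = q t" using * by (simp add: F_def)
      moreover have "residual L (?u @ [x t]) = q (t + 1)"
      proof -
        have "t + 1 - int (Suc (N + M)) = t - int (N + M)" by simp
        then show ?thesis using *(2) u unfolding F_def by metis
      qed
      ultimately show ?thesis unfolding E_def by blast
    qed
    then show "x \<in> {x. \<exists>q. \<forall>t::int. (q t, x t, q (t + 1)) \<in> E}" by blast
  next
    fix x assume "x \<in> {x. \<exists>q. \<forall>t::int. (q t, x t, q (t + 1)) \<in> E}"
    then obtain q where q: "\<And>t::int. (q t, x t, q (t + 1)) \<in> E" by blast
    show "x \<in> shift_of L"
      unfolding shift_of_def
    proof (intro CollectI allI)
      fix a n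
      obtain u where u: "q a = residual L u" "u \<in> L"
        using q[of a] fac[of "[]"] by (fastforce simp: E_def)
      \<comment> \<open>Following the walk from \<open>a\<close> on extends the word
        \<open>u\<close> that represents the state \<open>q a\<close>.\<close>
      have "q (a + int n) = residual L (u @ window x a n) \<and> u @ window x a n \<in> L"
      proof (induction n)
        case 0
        then show ?case using u by (simp add: window_def)
      next
        case (Suc n)
        obtain u' where u': "q (a + int n) = residual L u'" "u' @ [x (a + int n)] \<in> L"
          "q (a + int n + 1) = residual L (u' @ [x (a + int n)])"
          using q[of "a + int n"] by (auto simp: E_def)
        \<comment> \<open>The edge comes with its own representative \<open>u'\<close>, but its
          target depends only on the residual of \<open>u'\<close>, so
          \<open>u @ window x a n\<close> can replace it.\<close>
        then have eq: "residual L u' = residual L (u @ window x a n)" using Suc by simp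
        then have "q (a + int n + 1) = residual L (u @ window x a (Suc n))"
          using u'(3) unfolding window_Suc append.assoc[symmetric] residual_snoc by simp
        moreover have "u @ window x a (Suc n) \<in> L"
          using eq u'(2) by (auto simp: residual_def window_Suc)
        ultimately show ?case by (simp add: ac_simps)
      qed
      then show "window x a n \<in> L" using fac[of u _ "[]"] by simp
    qed
  qed
  ultimately show ?thesis by (rule soficI)
qed

text \<open>The residual of \<open>u\<close> depends only on the set of vertices at which walks
  reading \<open>u\<close> can arrive, and a finite graph has finitely many sets of
  vertices.\<close>

lemma regular_language_sofic:
  assumes "sofic X"
  shows "regular (language X)"
proof -
  obtain G :: "(nat, nat) pre_digraph" and lab where G: "fin_digraph G"
    and X: "X = {\<lambda>i. lab (e i) | e. biinfinite_walk G e}"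
    using assms unfolding sofic_def by blast
  interpret fin_digraph G by (fact G)
  define V where "V u = {tail G (e (a + int (length u))) | e a.
      biinfinite_walk G e \<and> window (\<lambda>i. lab (e i)) a (length u) = u}" for u
  define follow where "follow T = {v. \<exists>e b. biinfinite_walk G e \<and> tail G (e b) \<in> T \<and>
      window (\<lambda>i. lab (e i)) b (length v) = v}" for T
  have "residual (language X) u = follow (V u)" for u
  proof (intro set_eqI iffI)
    fix v assume "v \<in> residual (language X) u"
    then obtain e a n where e: "biinfinite_walk G e" "window (\<lambda>i. lab (e i)) a n = u @ v"
      unfolding residual_def language_def X by auto
    note w = window_eq_appendD[OF e(2)]
    have "tail G (e (a + int (length u))) \<in> V u" unfolding V_def using e(1) w(1)[symmetric] by blast
    then show "v \<in> follow (V u)" unfolding follow_def using e(1) w(2)[symmetric] by blast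
  next
    fix v assume "v \<in> follow (V u)"
    then obtain e1 e2 a b where e: "biinfinite_walk G e1" "biinfinite_walk G e2"
      "tail G (e2 b) = tail G (e1 (a + int (length u)))"
      "window (\<lambda>i. lab (e1 i)) a (length u) = u" "window (\<lambda>i. lab (e2 i)) b (length v) = v"
      unfolding follow_def V_def by auto
    define c where "c = a + int (length u)"
    \<comment> \<open>Glues the two walks at their common vertex: \<open>e1\<close> before
      \<open>c\<close>, then \<open>e2\<close> moved so that its position \<open>b\<close> falls on
      \<open>c\<close>.\<close>
    define e where "e t = (if t < c then e1 t else e2 (t - c + b))" for t
    have "biinfinite_walk G e"
      unfolding biinfinite_walk_def
    proof
      fix i
      have 1: "e1 i \<in> arcs G" "head G (e1 i) = tail G (e1 (i + 1))"
        using e(1) by (auto simp: biinfinite_walk_def)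
      have 2: "e2 (i - c + b) \<in> arcs G" "head G (e2 (i - c + b)) = tail G (e2 (i + 1 - c + b))"
        using e(2) by (auto simp: biinfinite_walk_def algebra_simps)
      consider "i + 1 < c" | "i + 1 = c" | "i \<ge> c" by linarith
      then show "e i \<in> arcs G \<and> head G (e i) = tail G (e (i + 1))"
      proof cases
        case 2
        then show ?thesis using 1 e(3) by (auto simp: e_def c_def)
      qed (use 1 2 in \<open>auto simp: e_def\<close>)
    qed
    moreover have "window (\<lambda>i. lab (e i)) a (length u + length v) = u @ v"
    proof -
      have "window (\<lambda>i. lab (e i)) a (length u) = u"
        using e(4) window_cong[of a "length u" "\<lambda>i. lab (e i)" "\<lambda>i. lab (e1 i)"]
        by (simp add: e_def c_def)
      moreover have "window (\<lambda>i. lab (e i)) c (length v) = v"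
        using e(5) by (simp add: window_def e_def add.commute)
      ultimately show ?thesis by (simp add: window_add c_def)
    qed
    moreover have "(\<lambda>i. lab (e i)) \<in> X" using calculation(1) unfolding X by blast
    ultimately have "u @ v \<in> language X" by (metis languageI)
    then show "v \<in> residual (language X) u" by (simp add: residual_def)
  qed
  moreover have "V u \<subseteq> verts G" for u
    by (auto simp: V_def biinfinite_walk_def)
  ultimately show ?thesis
    by (intro regularI[of "follow ` Pow (verts G)"]) auto
qed

section \<open>The language of a shift of concatenations\<close>

lemma nth_concat_take:
  assumes "r < length ws" "j < length (ws ! r)"
  shows "concat ws ! (length (concat (take r ws)) + j) = ws ! r ! j"
    "length (concat (take r ws)) + j < length (concat ws)"
proof -
  have "concat ws = concat (take r ws) @ ws ! r @ concat (drop (Suc r) ws)"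
    using id_take_nth_drop[OF assms(1)] by (metis concat.simps(2) concat_append)
  then show "concat ws ! (length (concat (take r ws)) + j) = ws ! r ! j"
    "length (concat (take r ws)) + j < length (concat ws)"
    using assms(2) by (auto simp: nth_append)
qed

text \<open>The point repeats \<open>concat ws\<close> periodically, with a copy starting at
  \<open>c\<close>; its blocks are the members of \<open>ws\<close> taken cyclically.\<close>

lemma periodic_in_biinfinite_concats:
  assumes ws: "set ws \<subseteq> W" "ws \<noteq> []"
  shows "(\<lambda>t. concat ws ! nat ((t - c) mod int (length (concat ws)))) \<in> biinfinite_concats W"
proof -
  let ?l = "length ws" and ?M = "length (concat ws)"
  define r where "r i = nat (i mod int ?l)" for i
  define w where "w i = ws ! r i" for i
  \<comment> \<open>Start of block \<open>i\<close>: the completed rounds through \<open>ws\<close>,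
    then the earlier blocks of the current round.\<close>
  define k where "k i = c + (i div int ?l) * int ?M + int (length (concat (take (r i) ws)))" for i
  have l: "int ?l > 0" using ws by simp
  have r: "r i < ?l" for i using l by (simp add: r_def nat_less_iff)
  have int_r: "int (r i) = i mod int ?l" for i using l by (simp add: r_def)
  have "w i \<in> W" for i using ws r by (auto simp: w_def)
  moreover have "k (i + 1) = k i + int (length (w i))" for i
  proof -
    have len: "length (concat (take (Suc (r i)) ws)) = length (concat (take (r i) ws)) + length (w i)"
      using r[of i] by (simp add: take_Suc_conv_app_nth w_def)
    show ?thesis
    proof (cases "Suc (r i) = ?l")
      case True
      then have "i mod int ?l = int ?l - 1" using int_r[of i] by linarith
      moreover have "int ?l * (i div int ?l + 1) = int ?l * (i div int ?l) + int ?l"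
        by (simp add: distrib_left)
      ultimately have i: "i + 1 = int ?l * (i div int ?l + 1)"
        using mult_div_mod_eq[of "int ?l" i] by linarith
      then have "(i + 1) div int ?l = i div int ?l + 1" "(i + 1) mod int ?l = 0"
        using l by (metis nonzero_mult_div_cancel_left less_irrefl, metis mod_mult_self1_is_0)
      moreover have "?M = length (concat (take (r i) ws)) + length (w i)" using len True by simp
      ultimately show ?thesis by (simp add: k_def r_def algebra_simps)
    next
      case False
      then have lt: "i mod int ?l + 1 < int ?l" using l r[of i] unfolding r_def by linarith
      have i: "i + 1 = (i mod int ?l + 1) + int ?l * (i div int ?l)" by simp
      have "(i + 1) mod int ?l = i mod int ?l + 1" "(i + 1) div int ?l = i div int ?l"
        using lt l
        by (subst i, subst mod_mult_self2, simp, subst i, subst div_mult_self2, auto)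
      then have "r (i + 1) = Suc (r i)" "(i + 1) div int ?l = i div int ?l"
        using l by (auto simp: r_def nat_add_distrib)
      then show ?thesis using len by (simp add: k_def)
    qed
  qed
  moreover have "concat ws ! nat ((k i + int j - c) mod int ?M) = w i ! j"
    if "j < length (w i)" for i j
  proof -
    note n = nth_concat_take[OF r that[unfolded w_def]]
    have "(k i + int j - c) mod int ?M
        = (int (length (concat (take (r i) ws)) + j) + (i div int ?l) * int ?M) mod int ?M"
      by (simp add: k_def algebra_simps)
    also have "\<dots> = int (length (concat (take (r i) ws)) + j)"
      using n(2) by (subst mod_mult_self1) (simp only: zmod_int[symmetric] mod_less)
    finally have "nat ((k i + int j - c) mod int ?M) = length (concat (take (r i) ws)) + j"
      by (simp only: nat_int)
    then show ?thesis using n(1) by (simp add: w_def)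
  qed
  ultimately show ?thesis unfolding biinfinite_concats_def by blast
qed

text \<open>The phase \<open>a - int (length z)\<close> puts the copy of \<open>v\<close> inside
  \<open>concat ws\<close> at coordinate \<open>a\<close>.\<close>

lemma window_periodic:
  assumes "concat ws = z @ v @ z'"
  shows "window (\<lambda>t. concat ws ! nat ((t - (a - int (length z))) mod int (length (concat ws))))
    a (length v) = v"
proof (rule nth_equalityI)
  fix j assume "j < length (window (\<lambda>t. concat ws ! nat ((t - (a - int (length z)))
    mod int (length (concat ws)))) a (length v))"
  then have j: "j < length v" by simp
  then have "length z + j < length (concat ws)" using assms by simp
  then have "nat ((a + int j - (a - int (length z))) mod int (length (concat ws))) = length z + j"
    by (simp add: nat_mod_as_int[symmetric] add.commute flip: of_nat_add zmod_int)
  then show "window (\<lambda>t. concat ws ! nat ((t - (a - int (length z)))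
    mod int (length (concat ws)))) a (length v) ! j = v ! j"
    using j assms by (simp add: nth_append)
qed simp

lemma factor_in_biinfinite_concats:
  assumes v: "v \<in> factors (star W)" and W: "w0 \<in> W"
  obtains y where "y \<in> biinfinite_concats W" "window y a (length v) = v"
proof -
  obtain z z' ws where ws: "concat ws = z @ v @ z'" "set ws \<subseteq> W"
    using v unfolding factors_def star_iff by blast
  \<comment> \<open>Appending \<open>w0\<close> rules out an empty list of blocks, which cannot be
    repeated periodically.\<close>
  define ws' where "ws' = ws @ [w0]"
  have "concat ws' = z @ v @ (z' @ w0)" "set ws' \<subseteq> W" "ws' \<noteq> []"
    using ws W by (auto simp: ws'_def)
  then show thesis using periodic_in_biinfinite_concats window_periodic that by metis
qed

text \<open>Nonempty blocks make the boundaries \<open>k i\<close> unbounded in both directions, so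
  a product of whole blocks covers the window.\<close>

lemma window_biinfinite_concats:
  fixes y :: "int \<Rightarrow> 'a"
  assumes y: "y \<in> biinfinite_concats W" and W: "[] \<notin> W"
  shows "window y a n \<in> factors (star W)"
proof -
  from y obtain w :: "int \<Rightarrow> 'a list" and k :: "int \<Rightarrow> int"
    where wk: "\<forall>i. w i \<in> W \<and> k (i + 1) = k i + int (length (w i)) \<and>
      (\<forall>j < length (w i). y (k i + int j) = w i ! j)"
    unfolding biinfinite_concats_def mem_Collect_eq by (elim exE)
  then have w: "w i \<in> W" and k: "k (i + 1) = k i + int (length (w i))"
    and yw: "j < length (w i) \<Longrightarrow> y (k i + int j) = w i ! j" for i j
    by auto
  have len: "length (w i) \<ge> 1" for i using w[of i] W by (cases "w i") auto
  have grow: "k (i + int m) \<ge> k i + int m" for i m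
  proof (induction m)
    case (Suc m)
    then show ?case using k[of "i + int m"] len[of "i + int m"] by (simp add: algebra_simps)
  qed simp
  have star: "\<exists>l. window y (k i) l \<in> star W \<and> k (i + int m) = k i + int l" for i m
  proof (induction m)
    case 0
    then show ?case by (intro exI[of _ 0]) (simp add: window_def Nil_in_star)
  next
    case (Suc m)
    then obtain l where l: "window y (k i) l \<in> star W" "k (i + int m) = k i + int l" by blast
    have "window y (k (i + int m)) (length (w (i + int m))) = w (i + int m)"
      by (rule nth_equalityI) (auto simp: yw)
    then have "window y (k i) (l + length (w (i + int m))) \<in> star W"
      unfolding window_add using l star_append subset_star w by metis
    moreover have "k (i + int (Suc m)) = k i + int (l + length (w (i + int m)))"
      using k[of "i + int m"] l(2) by (simp add: algebra_simps)
    ultimately show ?case by blast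
  qed
  \<comment> \<open>Each block has length at least 1, so going back \<open>nat (k 0 - a)\<close>
    blocks from block 0 reaches a boundary at or before \<open>a\<close>.\<close>
  define i where "i = - int (nat (k 0 - a))"
  have "i + int (nat (k 0 - a)) = 0" by (simp add: i_def)
  then have "k i + int (nat (k 0 - a)) \<le> k 0" using grow[of i "nat (k 0 - a)"] by metis
  then have ki: "k i \<le> a" by linarith
  define m where "m = nat (a + int n - k i)"
  obtain l where l: "window y (k i) l \<in> star W" "k (i + int m) = k i + int l" using star by blast
  have le: "a + int n \<le> k i + int l" using grow[of i m] l(2) m_def by linarith
  define d where "d = nat (a - k i)"
  have a: "a = k i + int d" using ki by (simp add: d_def)
  have "l = d + (n + (l - d - n))" using le a by simp
  then have "window y (k i) l = window y (k i) d @ window y a n @ window y (a + int n) (l - d - n)"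
    using window_add a by metis
  then show ?thesis unfolding factors_def using l(1) by auto
qed

section \<open>Closure in the full shift\<close>

lemma topspace_full_shift: "topspace (full_shift A) = (UNIV \<rightarrow>\<^sub>E A)"
  by (simp add: full_shift_def)

text \<open>The cylinder of \<open>x\<close> on the coordinates from \<open>a\<close> to
  \<open>b - 1\<close>. Writing \<open>A \<inter> {x t}\<close> keeps it open whether or not
  \<open>x\<close> has its values in \<open>A\<close>.\<close>

lemma openin_full_shift_cylinder:
  "openin (full_shift A) (PiE UNIV (\<lambda>t. if a \<le> t \<and> t < b then A \<inter> {x t} else A))"
  unfolding full_shift_def
proof (rule product_topology_basis)
  have "{i. (if a \<le> i \<and> i < b then A \<inter> {x i} else A) \<noteq> topspace (discrete_topology A)} \<subseteq> {a..<b}"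
    by auto
  then show "finite {i. (if a \<le> i \<and> i < b then A \<inter> {x i} else A) \<noteq> topspace (discrete_topology A)}"
    using finite_subset by blast
qed auto

text \<open>Basic neighbourhoods restrict finitely many coordinates. So a point lies in the closure
  exactly when each of its windows occurs in a concatenation, and the words that occur there are the
  factors of \<open>star W\<close>.\<close>

lemma closure_biinfinite_concats:
  assumes W: "[] \<notin> W" "W \<noteq> {}" "W \<subseteq> lists A"
  shows "full_shift A closure_of biinfinite_concats W = shift_of (factors (star W))"
proof (intro set_eqI iffI)
  fix x assume x: "x \<in> full_shift A closure_of biinfinite_concats W"
  then have xA: "x \<in> UNIV \<rightarrow>\<^sub>E A" unfolding in_closure_of topspace_full_shift by (rule conjunct1)
  have cl: "\<exists>y. y \<in> biinfinite_concats W \<and> y \<in> T" if "x \<in> T" "openin (full_shift A) T" for T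
    using x that unfolding in_closure_of by simp
  show "x \<in> shift_of (factors (star W))"
    unfolding shift_of_def
  proof (intro CollectI allI)
    fix a n
    let ?U = "PiE UNIV (\<lambda>t. if a \<le> t \<and> t < a + int n then A \<inter> {x t} else A)"
    have "x \<in> ?U" using xA by auto
    then obtain y where y: "y \<in> biinfinite_concats W" "y \<in> ?U"
      using cl[OF \<open>x \<in> ?U\<close> openin_full_shift_cylinder] by (elim exE conjE)
    have "y t = x t" if "a \<le> t" "t < a + int n" for t
      using PiE_mem[OF y(2), of t] that by simp
    then have "window y a n = window x a n" by (intro window_cong) auto
    then show "window x a n \<in> factors (star W)"
      using window_biinfinite_concats[OF y(1) W(1)] by metis
  qed
next
  fix x assume "x \<in> shift_of (factors (star W))"
  then have x: "window x a n \<in> factors (star W)" for a n by (simp add: shift_of_def)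
  have fA: "factors (star W) \<subseteq> lists A"
    by (rule factors_star_subset_lists[OF W(3)])
  then have "window x t 1 \<in> lists A" for t using x by blast
  then have "x t \<in> A" for t by (simp add: window_def)
  then have xA: "x \<in> UNIV \<rightarrow>\<^sub>E A" by auto
  show "x \<in> full_shift A closure_of biinfinite_concats W"
    unfolding closure_of_def topspace_full_shift
  proof (intro CollectI conjI allI impI xA)
    fix T assume T: "x \<in> T \<and> openin (full_shift A) T"
    then have "\<exists>U. finite {i \<in> UNIV. U i \<noteq> topspace (discrete_topology A)} \<and>
        (\<forall>i\<in>UNIV. openin (discrete_topology A) (U i)) \<and> x \<in> PiE UNIV U \<and> PiE UNIV U \<subseteq> T"
      unfolding full_shift_def openin_product_topology_alt by (elim conjE bspec)
    then obtain U where "finite {i \<in> UNIV. U i \<noteq> topspace (discrete_topology A)}"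
      and U: "x \<in> PiE UNIV U" "PiE UNIV U \<subseteq> T"
      by (elim exE conjE) (rule that)
    then have fin: "finite {i. U i \<noteq> A}" by simp
    obtain N where N: "\<And>i. U i \<noteq> A \<Longrightarrow> \<bar>i\<bar> \<le> N"
    proof -
      have "finite (abs ` {i. U i \<noteq> A})" using fin by simp
      then show thesis using that by (metis (mono_tags, lifting) Max_ge imageI mem_Collect_eq)
    qed
    obtain w0 where "w0 \<in> W" using W(2) by blast
    \<comment> \<open>This window covers every coordinate that \<open>U\<close> restricts, so it
      suffices that \<open>y\<close> agrees with \<open>x\<close> there and has its letters in
      \<open>A\<close> elsewhere.\<close>
    then obtain y where y: "y \<in> biinfinite_concats W"
      "window y (- N) (length (window x (- N) (nat (2 * N + 1)))) = window x (- N) (nat (2 * N + 1))"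
      by (rule factor_in_biinfinite_concats[OF x])
    have yA: "y t \<in> A" for t
    proof -
      have "window y t 1 \<in> lists A"
        using window_biinfinite_concats[OF y(1) W(1)] fA by blast
      then show ?thesis by (simp add: window_def)
    qed
    have "y t \<in> U t" for t
    proof (cases "U t = A")
      case False
      then have "\<bar>t\<bar> \<le> N" using N by blast
      then have j: "nat (t + N) < nat (2 * N + 1)" "t = - N + int (nat (t + N))" by auto
      then have "y t = x t" using y(2) nth_window unfolding length_window by metis
      then show ?thesis using U(1) by auto
    qed (use yA in simp)
    then show "\<exists>y\<in>biinfinite_concats W. y \<in> T" using y(1) U(2) by blast
  qed
qed

text \<open>Every factor occurs in a concatenation, hence in a point of the shift. So the follower
  sets of the shift are residuals of the factor language.\<close>

lemma language_shift_of_factors_star: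
  assumes W: "[] \<notin> W" "W \<noteq> {}"
  shows "language (shift_of (factors (star W))) = factors (star W)"
proof
  show "language (shift_of (factors (star W))) \<subseteq> factors (star W)"
    by (auto simp: language_def shift_of_def)
  show "factors (star W) \<subseteq> language (shift_of (factors (star W)))"
  proof
    fix v assume "v \<in> factors (star W)"
    then obtain y where y: "y \<in> biinfinite_concats W" "window y 0 (length v) = v"
      using factor_in_biinfinite_concats W(2) by (metis ex_in_conv)
    then have "y \<in> shift_of (factors (star W))"
      using window_biinfinite_concats[OF _ W(1)] by (simp add: shift_of_def)
    then show "v \<in> language (shift_of (factors (star W)))"
      using y(2) languageI by metis
  qed
qed

section \<open>Run lengths in concatenations of core words\<close>

text \<open>With nonempty runs and distinct neighbouring letters the listed runs are the maximal
  ones, and the block of \<open>i\<close> between \<open>c\<close> and \<open>d\<close> is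
  maximal.\<close>

lemma run_of_concat_replicate:
  assumes "concat (map (\<lambda>(a, m). replicate m a) rs) = x @ c # replicate n i @ d # y"
    and "c \<noteq> i" "d \<noteq> i" "n \<ge> 1"
    and "\<And>a m. (a, m) \<in> set rs \<Longrightarrow> m \<ge> 1" and "distinct_adj (map fst rs)"
  shows "(i, n) \<in> set rs"
  using assms(1,5,6)
proof (induction rs arbitrary: x)
  case Nil
  then show ?case by simp
next
  case (Cons r rs)
  obtain a m where r: "r = (a, m)" by force
  let ?w = "concat (map (\<lambda>(a, m). replicate m a) rs)"
  have eq: "replicate m a @ ?w = x @ c # replicate n i @ d # y" using Cons.prems(1) r by simp
  show ?case
  proof (cases "m \<le> length x")
    case True
    then have "?w = drop m x @ c # replicate n i @ d # y"
      using arg_cong[OF eq, of "drop m"] by simp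
    moreover have "distinct_adj (map fst rs)"
      using Cons.prems(3) by (cases rs) (auto simp: r)
    ultimately show ?thesis using Cons.IH Cons.prems(2) by force
  next
    case False
    then have "m = length x + Suc (m - Suc (length x))" by simp
    \<comment> \<open>The first run contains \<open>c\<close>; \<open>l\<close> counts its letters
      after \<open>c\<close>, and there are none because the next letter is
      \<open>i \<noteq> c\<close>.\<close>
    then obtain l where m: "m = length x + Suc l" by blast
    have "(replicate m a @ ?w) ! length x = a" using False by (simp add: nth_append)
    then have "c = a" unfolding eq by simp
    have "replicate l a @ ?w = replicate n i @ d # y"
      using arg_cong[OF eq, of "drop (Suc (length x))"] m by simp
    moreover have "l = 0"
    proof (rule ccontr)
      assume "l \<noteq> 0"
      then have "hd (replicate n i @ d # y) = a"
        using calculation by (metis Nil_is_append_conv hd_append2 hd_replicate replicate_empty)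
      then show False using \<open>c = a\<close> \<open>c \<noteq> i\<close> \<open>n \<ge> 1\<close> by (cases n) auto
    qed
    ultimately have w: "?w = replicate n i @ d # y" by simp
    then obtain b k rs' where rs: "rs = (b, k) # rs'" by (cases rs) auto
    then have "k \<ge> 1" using Cons.prems(2)[of b k] by simp
    let ?w' = "concat (map (\<lambda>(a, m). replicate m a) rs')"
    have w': "replicate k b @ ?w' = replicate n i @ d # y" using w rs by simp
    then have "b = i" using \<open>k \<ge> 1\<close> \<open>n \<ge> 1\<close> by (cases k; cases n) auto
    \<comment> \<open>The next run consists of \<open>i\<close>. If it were longer than
      \<open>n\<close> it would cover \<open>d\<close>; if shorter, the run after it would again
      consist of \<open>i\<close>.\<close>
    have "\<not> n < k"
    proof
      assume "n < k"
      then have "(replicate k b @ ?w') ! n = i" using \<open>b = i\<close> by (simp add: nth_append)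
      then show False using w' \<open>d \<noteq> i\<close> by (simp add: nth_append)
    qed
    moreover have "\<not> k < n"
    proof
      assume "k < n"
      then have "n = k + Suc (n - Suc k)" by simp
      then obtain j where n: "n = k + Suc j" by blast
      have w'': "?w' = i # replicate j i @ d # y"
        using arg_cong[OF w', of "drop k"] by (simp add: n replicate_add del: add_Suc_right)
      then obtain b' k' rs'' where rs': "rs' = (b', k') # rs''" by (cases rs') auto
      then have "k' \<ge> 1" using Cons.prems(2)[of b' k'] rs by simp
      then have "b' = i" using w'' rs' by (cases k') auto
      then show False using Cons.prems(3) \<open>b = i\<close> r rs rs' by simp
    qed
    ultimately show ?thesis using rs \<open>b = i\<close> by simp
  qed
qed

section \<open>Core words and their complete runs\<close>

locale limited_shift_data =
  fixes p :: nat and S :: "nat \<Rightarrow> nat set"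
  assumes p: "p \<ge> 2"
    and pos: "\<And>i. i \<in> {1..p} \<Longrightarrow> S i \<subseteq> {1..}"
    and nonempty: "\<And>i. i \<in> {1..p} \<Longrightarrow> S i \<noteq> {}"
begin

lemma core_setI: "(\<And>i. i \<in> {1..p} \<Longrightarrow> m i \<in> S i) \<Longrightarrow> runs m [1..<Suc p] \<in> core_set p S"
  unfolding core_set_eq by blast

lemma core_set_nonempty: "core_set p S \<noteq> {}"
proof -
  have "runs (\<lambda>i. SOME k. k \<in> S i) [1..<Suc p] \<in> core_set p S"
    using nonempty by (intro core_setI) (simp add: some_in_eq)
  then show ?thesis by blast
qed

lemma core_set_subset_lists: "core_set p S \<subseteq> lists {1..p}"
proof
  fix w assume "w \<in> core_set p S"
  then obtain m where "w = runs m [1..<Suc p]" unfolding core_set_eq by blast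
  then have "set w \<subseteq> set [1..<Suc p]" using set_runs by metis
  then show "w \<in> lists {1..p}" by auto
qed

lemma Nil_notin_core_set: "[] \<notin> core_set p S"
proof
  assume "[] \<in> core_set p S"
  then obtain m where m: "runs m [1..<Suc p] = []" "\<forall>i\<in>{1..p}. m i \<in> S i"
    unfolding core_set_eq mem_Collect_eq by metis
  have "[1..<Suc p] = []"
    by (rule runs_eq_Nil[OF m(1)]) (use m(2) pos in force)
  then show False using p by simp
qed

text \<open>A core word starts with 1 and ends with \<open>p \<noteq> 1\<close>, so runs do not
  merge where two core words meet. The last conjunct provides for this in the induction.\<close>

lemma star_core_set_runs:
  assumes "w \<in> star (core_set p S)"
  shows "\<exists>rs. concat (map (\<lambda>(a, m). replicate m a) rs) = w \<and> distinct_adj (map fst rs) \<and>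
    (\<forall>(a, m)\<in>set rs. m \<in> S a \<and> m \<ge> 1) \<and> (rs \<noteq> [] \<longrightarrow> fst (hd rs) = 1)"
proof -
  obtain ws where "concat ws = w" "set ws \<subseteq> core_set p S"
    using assms unfolding star_iff by blast
  then show ?thesis
  proof (induction ws arbitrary: w)
    case Nil
    then show ?case by (intro exI[of _ "[]"]) simp
  next
    case (Cons u ws)
    from Cons.prems(2) have "set ws \<subseteq> core_set p S" by simp
    from Cons.IH[OF refl this]
    obtain rs where rs: "concat (map (\<lambda>(a, m). replicate m a) rs) = concat ws"
      "distinct_adj (map fst rs)" "\<forall>(a, m)\<in>set rs. m \<in> S a \<and> m \<ge> 1"
      "rs \<noteq> [] \<longrightarrow> fst (hd rs) = 1"
      by (elim exE conjE) (rule that)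
    from Cons.prems(2) have "u \<in> core_set p S" by simp
    then obtain m where m: "u = runs m [1..<Suc p]" "\<forall>i\<in>{1..p}. m i \<in> S i"
      unfolding core_set_eq by blast
    define rs' where "rs' = map (\<lambda>i. (i, m i)) [1..<Suc p]"
    have fst: "map fst rs' = [1..<Suc p]" by (simp add: rs'_def comp_def)
    have "concat (map (\<lambda>(a, m). replicate m a) (rs' @ rs)) = w"
      using rs(1) Cons.prems(1) m(1) by (auto simp: rs'_def runs_def comp_def simp del: upt_Suc)
    moreover have "distinct_adj (map fst (rs' @ rs))"
    proof -
      have "last (map fst rs') = p" "hd (map fst rs') = 1" using p unfolding fst
        by (simp_all del: upt_Suc)
      moreover have "distinct_adj (map fst rs')" unfolding fst
        by (simp add: distinct_adj_conv_nth del: upt_Suc)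
      ultimately show ?thesis
        using rs(2,4) p by (auto simp: distinct_adj_append_iff hd_map)
    qed
    moreover have "\<forall>(a, m)\<in>set (rs' @ rs). m \<in> S a \<and> m \<ge> 1"
      using rs(3) m(2) pos by (force simp: rs'_def)
    moreover have "fst (hd (rs' @ rs)) = 1"
      using p by (simp add: rs'_def hd_append hd_map del: upt_Suc)
    ultimately show ?case by blast
  qed
qed

text \<open>In the word below the run of \<open>i\<close> is complete: its neighbours on both sides are
  other letters, also for \<open>i = 1\<close> and \<open>i = p\<close>.\<close>

lemma marked_run_in_factors_iff:
  assumes m: "\<And>j. j \<in> {1..p} \<Longrightarrow> m j \<in> S j" and i: "i \<in> {1..p}" and n: "n \<ge> 1"
  shows "p # runs m [1..<i] @ replicate n i @ runs m [Suc i..<Suc p] @ [1]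
    \<in> factors (star (core_set p S)) \<longleftrightarrow> n \<in> S i"
proof
  let ?u = "p # runs m [1..<i]" and ?v = "runs m [Suc i..<Suc p] @ [1]"
  have m1: "m j \<ge> 1" if "j \<in> {1..p}" for j using m[OF that] pos[OF that] by auto
  {
    \<comment> \<open>The letter before the run is \<open>p\<close> if \<open>i = 1\<close>, where
      \<open>p \<ge> 2\<close> matters, and smaller than \<open>i\<close> otherwise.\<close>
    have "last ?u \<noteq> i"
    proof (cases "runs m [1..<i] = []")
      case True
      have "[1..<i] = []" by (rule runs_eq_Nil[OF True]) (use i m1 in auto)
      then show ?thesis using True i p by simp
    next
      case False
      then have "last (runs m [1..<i]) \<in> set [1..<i]"
        using set_runs last_in_set by (metis subsetD)
      then show ?thesis using False by simp
    qed
    \<comment> \<open>The letter after the run is 1 if \<open>i = p\<close>, and larger than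
      \<open>i\<close> otherwise.\<close>
    moreover have "hd ?v \<noteq> i"
    proof (cases "runs m [Suc i..<Suc p] = []")
      case True
      have "[Suc i..<Suc p] = []" by (rule runs_eq_Nil[OF True]) (use i m1 in auto)
      then have "i = p" using i by (simp split: if_splits)
      then show ?thesis using True p by simp
    next
      case False
      then have "hd (runs m [Suc i..<Suc p]) \<in> set [Suc i..<Suc p]"
        using set_runs hd_in_set by (metis subsetD)
      then show ?thesis using False by (simp add: hd_append del: upt_Suc)
    qed
    moreover assume "p # runs m [1..<i] @ replicate n i @ runs m [Suc i..<Suc p] @ [1]
      \<in> factors (star (core_set p S))"
    then obtain x y where "x @ ?u @ replicate n i @ ?v @ y \<in> star (core_set p S)"
      unfolding factors_def by auto
    then obtain rs where rs: "concat (map (\<lambda>(a, m). replicate m a) rs) = x @ ?u @ replicate n i @ ?v @ y"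
      "distinct_adj (map fst rs)" "\<forall>(a, m)\<in>set rs. m \<in> S a \<and> m \<ge> 1"
      using star_core_set_runs by blast
    have "?u = butlast ?u @ [last ?u]" by (rule append_butlast_last_id[symmetric]) simp
    moreover have "?v = hd ?v # tl ?v" by (rule list.collapse[symmetric]) simp
    ultimately obtain u' c d v' where "?u = u' @ [c]" "c \<noteq> i" "?v = d # v'" "d \<noteq> i" by blast
    then have "(i, n) \<in> set rs"
      using rs n by (intro run_of_concat_replicate[of rs "x @ u'" c n i d "v' @ y"]) auto
    then show "n \<in> S i" using rs(3) by auto
  }
  assume "n \<in> S i"
  define w where "w = runs m [1..<Suc p]"
  have "w \<in> core_set p S" using m core_setI by (simp add: w_def del: upt_Suc)
  have split: "[1..<Suc p] = [1..<i] @ i # [Suc i..<Suc p]"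
    using upt_add_eq_append[of 1 i "Suc p - i"] upt_conv_Cons[of i "Suc p"] i
    by (simp del: upt_Suc)
  have "runs (m(i := n)) [1..<Suc p]
      = runs m [1..<i] @ replicate n i @ runs m [Suc i..<Suc p]"
    unfolding split by (simp add: runs_append runs_Cons runs_fun_upd del: upt_Suc)
  moreover have "runs (m(i := n)) [1..<Suc p] \<in> core_set p S"
    using m \<open>n \<in> S i\<close> by (intro core_setI) auto
  ultimately have u: "runs m [1..<i] @ replicate n i @ runs m [Suc i..<Suc p] \<in> core_set p S"
    by metis
  obtain x where x: "w = x @ [p]"
  proof -
    obtain k where "m p = Suc k" using m1[of p] p by (cases "m p") auto
    then have "w = (runs m [1..<p] @ replicate k p) @ [p]"
      using p by (simp add: w_def runs_append runs_Cons replicate_append_same)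
    then show thesis by (rule that)
  qed
  obtain y where y: "w = 1 # y"
  proof -
    obtain k where "m 1 = Suc k" using m1[of 1] p by (cases "m 1") auto
    then have "w = 1 # replicate k 1 @ runs m [2..<Suc p]"
      using p by (simp add: w_def upt_conv_Cons runs_Cons numeral_2_eq_2 del: upt_Suc)
    then show thesis by (rule that)
  qed
  \<comment> \<open>Two copies of a core word supply the marks: the left one ends in
    \<open>p\<close>, the right one starts with 1.\<close>
  have "w @ (runs m [1..<i] @ replicate n i @ runs m [Suc i..<Suc p]) @ w \<in> star (core_set p S)"
    using u \<open>w \<in> core_set p S\<close> star_append[OF subset_star star_append[OF subset_star subset_star]]
    by blast
  then have "x @ (p # runs m [1..<i] @ replicate n i @ runs m [Suc i..<Suc p] @ [1]) @ y
      \<in> star (core_set p S)"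
    by (subst (asm) x, subst (asm) y) (simp del: upt_Suc)
  then show "p # runs m [1..<i] @ replicate n i @ runs m [Suc i..<Suc p] @ [1]
    \<in> factors (star (core_set p S))"
    unfolding factors_def by blast
qed

text \<open>The residual after a prefix ending in \<open>Suc k\<close> letters \<open>i\<close>
  determines which \<open>n\<close> satisfy \<open>Suc k + n \<in> S i\<close>; two equal residuals
  thus make two translates of \<open>S i\<close> coincide.\<close>

lemma regular_factors_imp_eventually_periodic_set:
  assumes reg: "regular (factors (star (core_set p S)))" and i: "i \<in> {1..p}"
  shows "eventually_periodic_set (S i)"
proof -
  let ?L = "factors (star (core_set p S))"
  define m where "m j = (SOME k. k \<in> S j)" for j
  have m: "m j \<in> S j" if "j \<in> {1..p}" for j
    using nonempty[OF that] by (simp add: m_def some_in_eq)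
  \<comment> \<open>\<open>Suc k\<close> letters, so that the completed run is nonempty even when
    the continuation adds no further \<open>i\<close>.\<close>
  define F where "F k = residual ?L (p # runs m [1..<i] @ replicate (Suc k) i)" for k
  have F: "replicate n i @ runs m [Suc i..<Suc p] @ [1] \<in> F k \<longleftrightarrow> Suc k + n \<in> S i" for k n
    using marked_run_in_factors_iff[OF m i, of "Suc k + n"]
    unfolding F_def residual_def by (simp add: replicate_add del: upt_Suc)
  have "finite (range F)"
    by (rule finite_subset[OF _ reg[unfolded regular_def]]) (auto simp: F_def)
  then have "\<not> inj F" using finite_imageD infinite_UNIV_nat by blast
  then obtain k l where "F k = F l" "k < l"
    unfolding inj_def by (metis linorder_neqE_nat)
  then have per: "Suc k + n \<in> S i \<longleftrightarrow> Suc l + n \<in> S i" for n using F by blast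
  have "n + (l - k) \<in> S i \<longleftrightarrow> n \<in> S i" if "n \<ge> Suc k" for n
  proof -
    have "Suc k + (n - Suc k) = n" "Suc l + (n - Suc k) = n + (l - k)"
      using that \<open>k < l\<close> by auto
    then show ?thesis using per[of "n - Suc k"] by metis
  qed
  then show ?thesis
    unfolding eventually_periodic_set_def using \<open>k < l\<close> by (meson zero_less_diff)
qed

end

theorem proposition3p3:
  fixes p :: nat and S :: "nat \<Rightarrow> nat set"
  assumes "p \<ge> 2"
    and "\<And>i. i \<in> {1..p} \<Longrightarrow> S i \<subseteq> {1..}"
    and "\<And>i. i \<in> {1..p} \<Longrightarrow> S i \<noteq> {}"
  shows "sofic (limited_shift p S) \<longleftrightarrow> (\<forall>i\<in>{1..p}. eventually_periodic (Delta (S i)))"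
proof -
  interpret limited_shift_data p S
    by unfold_locales (use assms in auto)
  let ?W = "core_set p S"
  note W = Nil_notin_core_set core_set_nonempty core_set_subset_lists
  have X: "limited_shift p S = shift_of (factors (star ?W))"
    unfolding limited_shift_def by (rule closure_biinfinite_concats[OF W])
  show ?thesis
    unfolding eventually_periodic_Delta_iff
  proof
    assume "sofic (limited_shift p S)"
    then have "regular (factors (star ?W))"
      using regular_language_sofic language_shift_of_factors_star[OF W(1,2)] unfolding X by fastforce
    then show "\<forall>i\<in>{1..p}. eventually_periodic_set (S i)"
      using regular_factors_imp_eventually_periodic_set by blast
  next
    assume "\<forall>i\<in>{1..p}. eventually_periodic_set (S i)"
    then have "regular (factors (star ?W))"
      by (intro regular_factors regular_star regular_core_set) blast
    then show "sofic (limited_shift p S)"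
      unfolding X
      by (rule sofic_shift_of[OF _ finite_atLeastAtMost factors_star_subset_lists[OF W(3)]])
        (rule factors_append)
  qed
qed

end
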